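(* Let $U \subset \mathbb{R}^n$ be an open convex set and let $f \colon U \to \mathbb{R}$ be a convex function. Suppose $(x_k)_{k\ge 0}$ is a BFGS sequence for $f$ contained in $U$, and that the level set $\{x \in U : f(x) \le f(x_0)\}$ is bounded. Assume that there is an open set $V \subset U$ containing the closure $\mathrm{cl}\,\{x_k : k \ge 0\}$ of the sequence, satisfying $\inf_{x\in V} f(x) = \min f$, such that the Hessian $\nabla^2 f$ exists, is positive definite, and is continuous throughout $V$. Then the sequence of function values $f(x_k)$ converges to $\min f$.
   Context: Here $\min f$ denotes the minimum (infimum) value of $f$ over $U$. A sequence $(x_k)$ is a BFGS sequence for $f$ if $f$ is differentiable at each $x_k$ with $\nabla f(x_k) \neq 0$, and there exist parameters $0<\mu<\nu<1$ and a positive definite $n\times n$ matrix $H_0$ such that, with $s_k = x_{k+1}-x_k$, $y_k = \nabla f(x_{k+1}) - \nabla f(x_k)$, $V_k = I - \frac{s_k y_k^T}{s_k^T y_k}$ and $H_{k+1} = V_k H_k V_k^T + \frac{s_k s_k^T}{s_k^T y_k}$, one has for all $k=0,1,2,\dots$: $H_k \nabla f(x_k) \in -\mathbb{R}_+ s_k$, $f(x_{k+1}) \le f(x_k) + \mu \nabla f(x_k)^T s_k$ (Armijo condition), and $\nabla f(x_{k+1})^T s_k \ge \nu \nabla f(x_k)^T s_k$ (weak Wolfe condition). *)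

theory Defs
  imports "HOL-Analysis.Analysis"
begin

definition gradient :: "(real^'n \<Rightarrow> real) \<Rightarrow> real^'n \<Rightarrow> real^'n" where
  "gradient f x = (THE g. (f has_derivative (\<lambda>h. g \<bullet> h)) (at x))"

definition pos_def_mat :: "real^'n^'n \<Rightarrow> bool" where
  "pos_def_mat A \<longleftrightarrow> transpose A = A \<and> (\<forall>v. v \<noteq> 0 \<longrightarrow> v \<bullet> (A *v v) > 0)"

definition outer :: "real^'n \<Rightarrow> real^'n \<Rightarrow> real^'n^'n" where
  "outer u v = (\<chi> i j. u $ i * v $ j)"

text \<open>BFGS inverse-Hessian approximations H_k generated from H_0 along the sequence x.\<close>
primrec bfgs_H :: "(real^'n \<Rightarrow> real) \<Rightarrow> real^'n^'n \<Rightarrow> (nat \<Rightarrow> real^'n) \<Rightarrow> nat \<Rightarrow> real^'n^'n" where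
  "bfgs_H f H0 x 0 = H0"
| "bfgs_H f H0 x (Suc k) =
     (let s = x (Suc k) - x k;
          y = gradient f (x (Suc k)) - gradient f (x k);
          V = mat 1 - (1 / (s \<bullet> y)) *\<^sub>R outer s y
      in V ** bfgs_H f H0 x k ** transpose V + (1 / (s \<bullet> y)) *\<^sub>R outer s s)"

definition bfgs_seq :: "(real^'n \<Rightarrow> real) \<Rightarrow> (nat \<Rightarrow> real^'n) \<Rightarrow> bool" where
  "bfgs_seq f x \<longleftrightarrow>
     (\<forall>k. f differentiable (at (x k)) \<and> gradient f (x k) \<noteq> 0) \<and>
     (\<exists>\<mu> \<nu> H0. 0 < \<mu> \<and> \<mu> < \<nu> \<and> \<nu> < 1 \<and> pos_def_mat H0 \<and>
        (\<forall>k. let s = x (Suc k) - x k; g = gradient f (x k) in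
             (\<exists>t\<ge>0. bfgs_H f H0 x k *v g = - (t *\<^sub>R s)) \<and>
             f (x (Suc k)) \<le> f (x k) + \<mu> * (g \<bullet> s) \<and>
             gradient f (x (Suc k)) \<bullet> s \<ge> \<nu> * (g \<bullet> s)))"

definition hessian_pd_cont_on :: "(real^'n \<Rightarrow> real) \<Rightarrow> (real^'n) set \<Rightarrow> bool" where
  "hessian_pd_cont_on f V \<longleftrightarrow>
     (\<exists>Hf :: real^'n \<Rightarrow> real^'n^'n.
        (\<forall>x\<in>V. f differentiable (at x) \<and>
                (gradient f has_derivative (\<lambda>h. Hf x *v h)) (at x) \<and>
                pos_def_mat (Hf x)) \<and>
        continuous_on V Hf)"

end

theory Submission
  imports Defs
begin

text \<open>
  This is Powell's argument with the Byrd--Nocedal potential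
  $\psi(H) = \mathrm{tr}(H^{-1}) + \ln |\det H|$, which is bounded below on positive definite matrices
  because the entries of $H^{-1}$, hence its determinant, are controlled by its trace.
  On the compact closure of the sequence $|y_k|^2 \le M\, s_k^T y_k$ holds for some $M$. If the
  gradient norms stay above $\epsilon > 0$, the update formulas for trace and determinant,
  the Wolfe condition and $\ln r \le r$ give
  $\psi(H_{k+1}) \le \psi(H_k) + M + \ln (-g_k^T s_k / (\epsilon^2 (1-\nu)))$. The Armijo condition
  forces $g_k^T s_k \to 0$, so $\psi(H_k) \to -\infty$, a contradiction. Hence the gradient vanishes
  somewhere on the closure of the sequence, which by convexity is a minimizer.
\<close>

section \<open>Positive definite matrices and rank-one updates\<close>

lemma outer_mult_vec: "outer u v *v z = (v \<bullet> z) *\<^sub>R u"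
  by (simp add: outer_def matrix_vector_mult_def vec_eq_iff inner_vec_def sum_distrib_left
      sum_distrib_right ac_simps)

lemma transpose_outer: "transpose (outer u v) = outer v u"
  by (simp add: outer_def transpose_def vec_eq_iff mult.commute)

lemma trace_outer: "trace (outer u v) = u \<bullet> v"
  by (simp add: outer_def trace_def inner_vec_def)

lemma trace_scaleR: "trace (c *\<^sub>R A) = c * trace (A :: real^'n^'n)"
  by (simp add: trace_def sum_distrib_left)

lemma inner_mult_vec_transpose: "u \<bullet> (A *v v) = (transpose A *v u) \<bullet> (v :: real^'n)"
  for A :: "real^'n^'m"
  by (simp add: dot_lmul_matrix transpose_matrix_vector)

text \<open>The transpose is the identity with column \<open>k\<close> replaced by
  \<open>axis k 1 - c *\<^sub>R z\<close>, so Cramer's lemma reads off its determinant.\<close>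

lemma det_mat1_minus_outer_axis:
  "det (mat 1 - outer (axis k c) z) = 1 - c * (z :: real^'n) $ k"
proof -
  have "transpose (mat 1 - outer (axis k c) z)
      = (\<chi> i j. if j = k then (mat 1 *v (axis k 1 - c *\<^sub>R z)) $ i else (mat 1 :: real^'n^'n) $ i $ j)"
    unfolding matrix_vector_mul_lid by (auto simp: transpose_def outer_def vec_eq_iff axis_def mat_def)
  then have "det (transpose (mat 1 - outer (axis k c) z)) = 1 - c * z $ k"
    by (simp only: cramer_lemma) simp
  then show ?thesis
    by simp
qed

text \<open>Conjugation by an orthogonal matrix that carries a coordinate axis to the direction of
  \<open>s\<close> changes neither side, which leaves the case where \<open>s\<close> lies on an
  axis.\<close>

lemma det_mat1_minus_outer: "det (mat 1 - outer s w) = 1 - s \<bullet> (w :: real^'n)"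
proof (cases "s = 0")
  case True
  then have "outer s w = 0"
    by (simp add: outer_def vec_eq_iff)
  then show ?thesis
    using True by simp
next
  case False
  then have "norm (s /\<^sub>R norm s) = 1"
    by simp
  then obtain Q :: "real^'n^'n" and k where Q: "orthogonal_matrix Q" "Q *v axis k 1 = s /\<^sub>R norm s"
    using orthogonal_matrix_exists_basis by metis
  have QQ: "transpose Q ** Q = mat 1"
    using Q(1) by (simp add: orthogonal_matrix)
  have Qs: "transpose Q *v s = axis k (norm s)"
  proof -
    have "s = Q *v (norm s *\<^sub>R axis k 1)"
      using False Q(2) by (simp add: matrix_vector_mult_scaleR)
    then have "transpose Q *v s = norm s *\<^sub>R axis k 1"
      by (metis QQ matrix_vector_mul_assoc matrix_vector_mul_lid)
    then show ?thesis
      by (simp add: vec_eq_iff axis_def)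
  qed
  have "transpose Q ** (mat 1 - outer s w) ** Q = mat 1 - outer (axis k (norm s)) (transpose Q *v w)"
    unfolding matrix_eq matrix_vector_mul_assoc[symmetric] matrix_vector_mult_diff_rdistrib
      matrix_vector_mult_diff_distrib outer_mult_vec
    by (simp add: matrix_vector_mult_scaleR Qs inner_mult_vec_transpose matrix_vector_mul_assoc QQ
        del: transpose_matrix_vector)
  then have "det (transpose Q ** (mat 1 - outer s w) ** Q) = 1 - norm s * (transpose Q *v w) $ k"
    using det_mat1_minus_outer_axis by metis
  also have "norm s * (transpose Q *v w) $ k = axis k (norm s) \<bullet> (transpose Q *v w)"
    by (simp add: inner_axis' )
  also have "\<dots> = s \<bullet> w"
    by (metis Q(1) Qs inner_mult_vec_transpose matrix_vector_mul_assoc matrix_vector_mul_lid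
        orthogonal_matrix_def transpose_transpose)
  also have "det (transpose Q ** (mat 1 - outer s w) ** Q) = det (mat 1 - outer s w) * det (transpose Q ** Q)"
    by (simp add: det_mul)
  finally show ?thesis
    using QQ by simp
qed

section \<open>Inverses, entries and determinants of positive definite matrices\<close>

lemma pos_def_mat_of_left_inverse:
  fixes H B :: "real^'n^'n"
  assumes "pos_def_mat H" "B ** H = mat 1"
  shows "pos_def_mat B"
proof -
  have HB: "H ** B = mat 1"
    using assms(2) matrix_left_right_inverse by blast
  have "transpose B = transpose B ** (transpose H ** B)"
    using HB assms(1) by (simp add: pos_def_mat_def)
  also have "\<dots> = transpose (H ** B) ** B"
    by (simp add: matrix_transpose_mul matrix_mul_assoc)
  finally have sym: "transpose B = B"
    by (simp add: HB)
  \<comment> \<open>With u = B v, the form of B at v equals the form of H at u.\<close>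
  have "v \<bullet> (B *v v) > 0" if "v \<noteq> 0" for v
  proof -
    have v: "v = H *v (B *v v)"
      by (simp add: matrix_vector_mul_assoc HB)
    then have "B *v v \<noteq> 0"
      using that by force
    then have "(B *v v) \<bullet> (H *v (B *v v)) > 0"
      using assms(1) by (auto simp: pos_def_mat_def)
    then show ?thesis
      using v by (simp add: inner_commute)
  qed
  with sym show ?thesis
    by (simp add: pos_def_mat_def)
qed

text \<open>A positive definite matrix has trivial kernel, so the choice inside
  \<open>matrix_inv\<close> picks a genuine inverse.\<close>

lemma matrix_inv_left_pos_def:
  assumes "pos_def_mat H"
  shows "matrix_inv H ** H = mat 1"
proof -
  have "x = 0" if "H *v x = 0" for x
    using assms that by (force simp: pos_def_mat_def)
  then have "\<exists>B. B ** H = mat 1"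
    by (simp add: matrix_left_invertible_ker)
  then have "invertible H"
    by (simp add: invertible_left_inverse)
  then show ?thesis
    unfolding invertible_def matrix_inv_def by (rule someI2_ex) blast
qed

lemma pos_def_mat_diag_pos:
  assumes "pos_def_mat B"
  shows "B $ i $ i > 0"
proof -
  have "axis i 1 \<bullet> (B *v axis i 1) > 0"
    using assms by (simp add: pos_def_mat_def axis_eq_0_iff)
  then show ?thesis
    by (simp add: inner_axis' matrix_vector_mul_component inner_axis)
qed

lemma pos_def_mat_trace_pos: "pos_def_mat B \<Longrightarrow> trace B > 0"
  unfolding trace_def by (rule sum_pos) (auto simp: pos_def_mat_diag_pos)

text \<open>Testing the quadratic form on the sum and the difference of two coordinate vectors
  bounds twice an off-diagonal entry by the sum of two diagonal ones.\<close>

lemma pos_def_mat_entry_le_trace: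
  fixes B :: "real^'n^'n"
  assumes "pos_def_mat B"
  shows "\<bar>B $ i $ j\<bar> \<le> trace B"
proof (cases "i = j")
  case True
  then show ?thesis
    unfolding trace_def using pos_def_mat_diag_pos[OF assms]
    by (auto intro!: member_le_sum[of j UNIV "\<lambda>i. B $ i $ i"] simp: less_imp_le)
next
  case False
  have "transpose B $ i $ j = B $ i $ j"
    using assms by (simp add: pos_def_mat_def)
  then have sym: "B $ j $ i = B $ i $ j"
    by (simp add: transpose_def)
  have quad: "0 \<le> v \<bullet> (B *v v)" for v
    using assms by (cases "v = 0") (auto simp: pos_def_mat_def less_imp_le)
  have ax: "axis p 1 \<bullet> (B *v axis q 1) = B $ p $ q" for p q
    by (simp add: inner_axis' matrix_vector_mul_component inner_axis)
  have 1: "0 \<le> B $ i $ i + B $ j $ j + 2 * B $ i $ j"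
    using quad[of "axis i 1 + axis j 1"] sym
    by (simp add: algebra_simps inner_add_left inner_add_right ax)
  have 2: "0 \<le> B $ i $ i + B $ j $ j - 2 * B $ i $ j"
    using quad[of "axis i 1 - axis j 1"] sym
    by (simp add: algebra_simps inner_diff_left inner_diff_right ax)
  have "B $ i $ i + B $ j $ j = (\<Sum>p\<in>{i,j}. B $ p $ p)"
    using False by simp
  also have "\<dots> \<le> trace B"
    unfolding trace_def
    by (rule sum_mono2) (auto simp: less_imp_le pos_def_mat_diag_pos[OF assms])
  finally show ?thesis
    using 1 2 pos_def_mat_trace_pos[OF assms] by linarith
qed

text \<open>The Leibniz expansion has n! terms, each at most c^n in absolute value. The crude factor
  n! only shifts the lower bound of the potential by a constant.\<close>

lemma abs_det_le:
  fixes A :: "real^'n^'n"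
  assumes "\<And>i j. \<bar>A $ i $ j\<bar> \<le> c"
  shows "\<bar>det A\<bar> \<le> fact CARD('n) * c ^ CARD('n)"
proof -
  have "\<bar>det A\<bar> \<le> (\<Sum>p | p permutes (UNIV :: 'n set). \<bar>of_int (sign p) * (\<Prod>i\<in>UNIV. A $ i $ p i)\<bar>)"
    unfolding det_def by (rule sum_abs)
  also have "\<dots> \<le> (\<Sum>p | p permutes (UNIV :: 'n set). c ^ CARD('n))"
  proof (rule sum_mono)
    fix p :: "'n \<Rightarrow> 'n"
    have "\<bar>\<Prod>i\<in>UNIV. A $ i $ p i\<bar> \<le> (\<Prod>i\<in>(UNIV :: 'n set). c)"
      unfolding abs_prod by (rule prod_mono) (auto simp: assms)
    then show "\<bar>of_int (sign p) * (\<Prod>i\<in>UNIV. A $ i $ p i)\<bar> \<le> c ^ CARD('n)"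
      by (simp add: abs_mult sign_def)
  qed
  also have "\<dots> = fact CARD('n) * c ^ CARD('n)"
    by (simp add: card_permutations)
  finally show ?thesis .
qed

section \<open>The potential of a BFGS matrix\<close>

text \<open>In terms of B = H^(-1) this is tr B - ln |det B|. With the absolute value, the logarithm
  splits over products as soon as the determinants are nonzero.\<close>

definition bfgs_potential :: "real^'n^'n \<Rightarrow> real" where
  "bfgs_potential H = trace (matrix_inv H) + ln \<bar>det H\<bar>"

text \<open>With T the trace of the inverse, the potential is at least T - n ln T - ln n!, and T - n
  ln T is smallest at T = n.\<close>

lemma bfgs_potential_bounded_below:
  obtains c where "\<And>H :: real^'n^'n. pos_def_mat H \<Longrightarrow> c \<le> bfgs_potential H"
proof
  fix H :: "real^'n^'n"
  define n where "n = real CARD('n)"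
  define T where "T = trace (matrix_inv H)"
  assume H: "pos_def_mat H"
  note inv = matrix_inv_left_pos_def[OF H]
  have B: "pos_def_mat (matrix_inv H)"
    by (rule pos_def_mat_of_left_inverse[OF H inv])
  have T: "T > 0"
    unfolding T_def by (rule pos_def_mat_trace_pos[OF B])
  have n: "n > 0"
    by (simp add: n_def)
  have "det (matrix_inv H) * det H = 1"
    by (metis det_I det_mul inv)
  then have prod: "\<bar>det (matrix_inv H)\<bar> * \<bar>det H\<bar> = 1"
    by (metis abs_mult abs_one)
  then have D: "\<bar>det (matrix_inv H)\<bar> > 0" "\<bar>det H\<bar> > 0"
    by auto
  have "- ln \<bar>det H\<bar> = ln \<bar>det (matrix_inv H)\<bar>"
    using ln_mult_pos[OF D] prod by simp
  also have "\<dots> \<le> ln (fact CARD('n) * T ^ CARD('n))"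
    using D(1) abs_det_le[of "matrix_inv H", OF pos_def_mat_entry_le_trace[OF B]]
    unfolding T_def by (intro ln_mono) auto
  also have "\<dots> = ln (fact CARD('n)) + n * ln T"
    using T by (simp add: ln_mult_pos ln_realpow n_def)
  \<comment> \<open>Splitting off ln n makes the tangent bound ln r \<le> r - 1, taken at r = T / n,
    cost exactly T - n.\<close>
  also have "n * ln T = n * ln n + n * ln (T / n)"
    using T n by (simp add: ln_div algebra_simps)
  also have "n * ln (T / n) \<le> n * (T / n - 1)"
    using T n by (intro mult_left_mono ln_le_minus_one) auto
  also have "\<dots> = T - n"
    using n by (simp add: field_simps)
  finally show "n - ln (fact CARD('n)) - n * ln n \<le> bfgs_potential H"
    unfolding bfgs_potential_def T_def by simp
qed

section \<open>One BFGS update: inverse, product form, determinant, potential\<close>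

definition bfgs_update :: "real^'n^'n \<Rightarrow> real^'n \<Rightarrow> real^'n \<Rightarrow> real^'n^'n" where
  "bfgs_update H s y =
     (let V = mat 1 - (1 / (s \<bullet> y)) *\<^sub>R outer s y
      in V ** H ** transpose V + (1 / (s \<bullet> y)) *\<^sub>R outer s s)"

lemma transpose_diff: "transpose (A - B) = transpose A - transpose (B :: real^'n^'m)"
  by (simp add: transpose_def vec_eq_iff)

text \<open>Here \<open>q\<close> is H V^T v. Matrix identities for the update are checked below by
  applying both sides to a vector.\<close>

lemma bfgs_update_mult_vec:
  "bfgs_update H s y *v v =
     (let q = H *v (v - ((s \<bullet> v) / (s \<bullet> y)) *\<^sub>R y)
      in q + ((s \<bullet> v - y \<bullet> q) / (s \<bullet> y)) *\<^sub>R s)"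
  by (simp add: bfgs_update_def Let_def transpose_diff transpose_scalar transpose_outer
      matrix_vector_mult_diff_rdistrib matrix_vector_mult_add_rdistrib outer_mult_vec
      matrix_vector_mul_assoc[symmetric] scaleR_matrix_vector_assoc[symmetric]
      diff_divide_distrib scaleR_diff_left)

text \<open>This is the direct BFGS formula B - B s s^T B / (s^T B s) + y y^T / (s^T y). Because H g
  = -t s, the vector B s is -g/t, and the middle term becomes a multiple of g g^T.\<close>

lemma bfgs_update_inverse:
  fixes H B :: "real^'n^'n"
  assumes "pos_def_mat H" "B ** H = mat 1" "H *v g = - (t *\<^sub>R s)" "t \<noteq> 0" "g \<bullet> s \<noteq> 0" "s \<bullet> y \<noteq> 0"
  shows "(B + (1 / (t * (g \<bullet> s))) *\<^sub>R outer g g + (1 / (s \<bullet> y)) *\<^sub>R outer y y) ** bfgs_update H s y = mat 1"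
    (is "?B ** _ = _")
proof -
  have BH: "B *v (H *v v) = v" for v
    by (simp add: matrix_vector_mul_assoc assms(2))
  have "s = (- (1 / t)) *\<^sub>R (H *v g)"
    using assms(3,4) by simp
  then have Bs: "B *v s = (- (1 / t)) *\<^sub>R g"
    by (metis BH matrix_vector_mult_scaleR)
  have "?B *v (bfgs_update H s y *v v) = v" for v
  proof -
    define p where "p = v - ((s \<bullet> v) / (s \<bullet> y)) *\<^sub>R y"
    define q where "q = H *v p"
    define \<beta> where "\<beta> = (s \<bullet> v - y \<bullet> q) / (s \<bullet> y)"
    have upd: "bfgs_update H s y *v v = q + \<beta> *\<^sub>R s"
      by (simp add: bfgs_update_mult_vec p_def q_def \<beta>_def Let_def)
    \<comment> \<open>H g is parallel to s, so orthogonality of p to s makes q = H p orthogonal to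
      g, and the g g^T term vanishes on q.\<close>
    have "s \<bullet> p = 0"
      using assms(6) by (simp add: p_def inner_diff_right)
    then have gq: "g \<bullet> q = 0"
      using assms(1,3) by (simp add: q_def inner_mult_vec_transpose pos_def_mat_def)
    \<comment> \<open>On the multiple of s, the g g^T term cancels B s.\<close>
    have "?B *v (q + \<beta> *\<^sub>R s) = p + ((y \<bullet> q) / (s \<bullet> y) + \<beta>) *\<^sub>R y"
      using assms(4-6)
      by (simp add: matrix_vector_mult_add_rdistrib outer_mult_vec matrix_vector_right_distrib
          scaleR_matrix_vector_assoc[symmetric] matrix_vector_mult_scaleR Bs gq
          inner_add_right inner_commute[of s y] scaleR_add_left) (simp add: q_def BH)
    also have "(y \<bullet> q) / (s \<bullet> y) + \<beta> = (s \<bullet> v) / (s \<bullet> y)"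
      by (simp add: \<beta>_def diff_divide_distrib)
    also have "p + \<dots> *\<^sub>R y = v"
      by (simp add: p_def)
    finally show ?thesis
      by (simp add: upd)
  qed
  then show ?thesis
    by (simp add: matrix_eq matrix_vector_mul_assoc)
qed

text \<open>Matching coefficients in the ansatz $H_{+} = (I - s w^T) H (I - w s^T)$ forces
  $w = y / (s^T y) - (c/t) g$ with $c^2 = t / (s^T y \cdot (-g^T s))$.\<close>
lemma bfgs_update_product_form:
  fixes H :: "real^'n^'n"
  assumes "pos_def_mat H" "H *v g = - (t *\<^sub>R s)" "t > 0" "g \<bullet> s < 0" "s \<bullet> y > 0"
  obtains w where "bfgs_update H s y = (mat 1 - outer s w) ** H ** transpose (mat 1 - outer s w)"
    and "(1 - s \<bullet> w)\<^sup>2 = - (g \<bullet> s) / (t * (s \<bullet> y))"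
proof
  define \<sigma> where "\<sigma> = s \<bullet> y"
  define c where "c = sqrt (t / (\<sigma> * - (g \<bullet> s)))"
  define w where "w = (1 / \<sigma>) *\<^sub>R y - (c / t) *\<^sub>R g"
  have \<sigma>: "\<sigma> > 0"
    using assms by (simp add: \<sigma>_def)
  have "c\<^sup>2 = t / (\<sigma> * - (g \<bullet> s))"
    unfolding c_def using assms \<sigma> by (intro real_sqrt_pow2) (simp add: divide_nonneg_neg mult_pos_neg less_imp_le)
  then have c2: "c * c = - t / (\<sigma> * (g \<bullet> s))"
    by (simp add: power2_eq_square)
  have sw: "s \<bullet> w = 1 - (c / t) * (g \<bullet> s)"
    using \<sigma> by (simp add: w_def inner_diff_right \<sigma>_def inner_commute)
  have "(1 - s \<bullet> w)\<^sup>2 = (c * c) * (g \<bullet> s)\<^sup>2 / t\<^sup>2"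
    by (simp add: sw power2_eq_square)
  also have "\<dots> = - (g \<bullet> s) / (t * \<sigma>)"
    using assms \<sigma> by (simp add: c2 power2_eq_square field_simps)
  finally show "(1 - s \<bullet> w)\<^sup>2 = - (g \<bullet> s) / (t * (s \<bullet> y))"
    by (simp add: \<sigma>_def)
  have sym: "a \<bullet> (H *v b) = (H *v a) \<bullet> b" for a b
    using assms(1) by (simp add: inner_mult_vec_transpose pos_def_mat_def)
  have Hw: "H *v w = (1 / \<sigma>) *\<^sub>R (H *v y) + c *\<^sub>R s"
    using assms(2,3) by (simp add: w_def matrix_vector_mult_diff_distrib matrix_vector_mult_scaleR)
  have wHw: "w \<bullet> (H *v w) = (y \<bullet> (H *v y)) / \<sigma>\<^sup>2 + 1 / \<sigma> + 2 * c"
  proof -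
    have "w \<bullet> (H *v w) = (1 / \<sigma>) * ((H *v w) \<bullet> y) + c * (s \<bullet> w)"
      unfolding sym[of w y, symmetric] by (subst Hw) (simp add: inner_add_right inner_commute[of s w])
    also have "(H *v w) \<bullet> y = (1 / \<sigma>) * (y \<bullet> (H *v y)) + c * \<sigma>"
      by (simp add: Hw inner_add_left inner_commute[of "H *v y"] \<sigma>_def)
    also have "c * (s \<bullet> w) = c - (c * c) * (g \<bullet> s) / t"
      by (simp add: sw algebra_simps)
    \<comment> \<open>The choice of \<open>c\<close> enters here and produces the summand 1 /
      \<sigma>.\<close>
    also have "(c * c) * (g \<bullet> s) / t = - 1 / \<sigma>"
      using assms \<sigma> by (simp add: c2 field_simps)
    finally show ?thesis
      using \<sigma> by (simp add: distrib_left power2_eq_square)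
  qed
  have "bfgs_update H s y *v v = (mat 1 - outer s w) *v (H *v (transpose (mat 1 - outer s w) *v v))" for v
  proof -
    have "(mat 1 - outer s w) *v (H *v (transpose (mat 1 - outer s w) *v v))
        = H *v v - (s \<bullet> v) *\<^sub>R (H *v w) - (w \<bullet> (H *v v) - (s \<bullet> v) * (w \<bullet> (H *v w))) *\<^sub>R s"
      by (simp add: transpose_diff transpose_outer matrix_vector_mult_diff_rdistrib
          matrix_vector_mult_diff_distrib matrix_vector_mult_scaleR outer_mult_vec inner_diff_right)
        (simp add: algebra_simps)
    also have "w \<bullet> (H *v v) = (1 / \<sigma>) * (y \<bullet> (H *v v)) + c * (s \<bullet> v)"
      unfolding sym[of w] Hw by (simp add: inner_add_left sym)
    also have "(s \<bullet> v) *\<^sub>R (H *v w) = ((s \<bullet> v) / \<sigma>) *\<^sub>R (H *v y) + (c * (s \<bullet> v)) *\<^sub>R s"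
      by (simp add: Hw scaleR_add_right mult.commute)
    also have "H *v v - (((s \<bullet> v) / \<sigma>) *\<^sub>R (H *v y) + (c * (s \<bullet> v)) *\<^sub>R s)
        - ((1 / \<sigma>) * (y \<bullet> (H *v v)) + c * (s \<bullet> v) - (s \<bullet> v) * (w \<bullet> (H *v w))) *\<^sub>R s
        = H *v v - ((s \<bullet> v) / \<sigma>) *\<^sub>R (H *v y)
        + ((s \<bullet> v) * (w \<bullet> (H *v w)) - (1 / \<sigma>) * (y \<bullet> (H *v v)) - 2 * (c * (s \<bullet> v))) *\<^sub>R s"
      unfolding mult_2 scaleR_diff_left scaleR_add_left by simp
    \<comment> \<open>The summand 2 c of w^T H w cancels the two terms linear in c; its summand 1 /
      \<sigma> supplies the s s^T term of the update.\<close>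
    also have "(s \<bullet> v) * (w \<bullet> (H *v w)) - (1 / \<sigma>) * (y \<bullet> (H *v v)) - 2 * (c * (s \<bullet> v))
        = (s \<bullet> v - (y \<bullet> (H *v v) - (s \<bullet> v) / \<sigma> * (y \<bullet> (H *v y)))) / \<sigma>"
      unfolding wHw using \<sigma> by (simp add: field_simps power2_eq_square)
    finally show ?thesis
      unfolding bfgs_update_mult_vec Let_def \<sigma>_def
      by (simp add: matrix_vector_mult_diff_distrib matrix_vector_mult_scaleR inner_diff_right)
  qed
  then show "bfgs_update H s y = (mat 1 - outer s w) ** H ** transpose (mat 1 - outer s w)"
    by (simp only: matrix_eq matrix_vector_mul_assoc matrix_mul_assoc simp_thms)
qed

text \<open>The product form is a congruence E H E^T with det E = 1 - s^T w nonzero. It preserves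
  positive definiteness and multiplies the determinant by the square of det E.\<close>

lemma bfgs_update_pos_def_det:
  fixes H :: "real^'n^'n"
  assumes "pos_def_mat H" "H *v g = - (t *\<^sub>R s)" "t > 0" "g \<bullet> s < 0" "s \<bullet> y > 0"
  shows "pos_def_mat (bfgs_update H s y)"
    and "det (bfgs_update H s y) = det H * (- (g \<bullet> s) / (t * (s \<bullet> y)))"
proof -
  obtain w where w: "bfgs_update H s y = (mat 1 - outer s w) ** H ** transpose (mat 1 - outer s w)"
    and sw: "(1 - s \<bullet> w)\<^sup>2 = - (g \<bullet> s) / (t * (s \<bullet> y))"
    using bfgs_update_product_form[OF assms] by blast
  define E where "E = mat 1 - outer s w"
  have detE: "det E = 1 - s \<bullet> w"
    by (simp add: E_def det_mat1_minus_outer)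
  show "det (bfgs_update H s y) = det H * (- (g \<bullet> s) / (t * (s \<bullet> y)))"
    unfolding w E_def[symmetric] sw[symmetric] by (simp add: det_mul detE power2_eq_square)
  have "- (g \<bullet> s) / (t * (s \<bullet> y)) \<noteq> 0"
    using assms by simp
  then have "det (transpose E) \<noteq> 0"
    using detE sw by auto
  then have "invertible (transpose E)"
    using invertible_det_nz by blast
  then have ker: "v = 0" if "transpose E *v v = 0" for v
    using that by (metis invertible_def matrix_left_invertible_ker)
  have "v \<bullet> ((E ** H ** transpose E) *v v) > 0" if "v \<noteq> 0" for v
  proof -
    have "v \<bullet> ((E ** H ** transpose E) *v v) = (transpose E *v v) \<bullet> (H *v (transpose E *v v))"
      by (simp add: matrix_vector_mul_assoc[symmetric] inner_mult_vec_transpose[of v E])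
    then show ?thesis
      using assms(1) ker that by (auto simp: pos_def_mat_def)
  qed
  moreover have "transpose (E ** H ** transpose E) = E ** H ** transpose E"
    using assms(1) by (simp add: matrix_transpose_mul pos_def_mat_def matrix_mul_assoc)
  ultimately show "pos_def_mat (bfgs_update H s y)"
    unfolding w E_def[symmetric] by (simp add: pos_def_mat_def)
qed

text \<open>The trace changes by the two rank-one terms of the inverse formula, the logarithm by the
  determinant factor.\<close>

lemma bfgs_potential_update:
  fixes H :: "real^'n^'n"
  assumes "pos_def_mat H" "H *v g = - (t *\<^sub>R s)" "t > 0" "g \<bullet> s < 0" "s \<bullet> y > 0"
  shows "bfgs_potential (bfgs_update H s y) = bfgs_potential H
    - (g \<bullet> g) / (t * - (g \<bullet> s)) + (y \<bullet> y) / (s \<bullet> y) + ln (- (g \<bullet> s) / (t * (s \<bullet> y)))"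
proof -
  note inv = matrix_inv_left_pos_def[OF assms(1)]
  define B where "B = matrix_inv H + (1 / (t * (g \<bullet> s))) *\<^sub>R outer g g + (1 / (s \<bullet> y)) *\<^sub>R outer y y"
  have "B ** bfgs_update H s y = mat 1"
    unfolding B_def using assms by (intro bfgs_update_inverse inv) auto
  then have "matrix_inv (bfgs_update H s y) = B"
    using matrix_inv_left_pos_def[OF bfgs_update_pos_def_det(1)[OF assms]]
    by (metis matrix_left_right_inverse matrix_mul_assoc matrix_mul_lid matrix_mul_rid)
  then have tr: "trace (matrix_inv (bfgs_update H s y))
      = trace (matrix_inv H) - (g \<bullet> g) / (t * - (g \<bullet> s)) + (y \<bullet> y) / (s \<bullet> y)"
    by (simp add: B_def trace_add trace_scaleR trace_outer)
  have pos: "- (g \<bullet> s) / (t * (s \<bullet> y)) > 0"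
    using assms by (intro divide_pos_pos mult_pos_pos) auto
  have "det H \<noteq> 0"
    using inv by (metis invertible_det_nz invertible_left_inverse)
  then have "ln \<bar>det (bfgs_update H s y)\<bar> = ln \<bar>det H\<bar> + ln (- (g \<bullet> s) / (t * (s \<bullet> y)))"
    unfolding bfgs_update_pos_def_det(2)[OF assms] abs_mult abs_of_pos[OF pos]
    using pos by (intro ln_mult_pos) auto
  with tr show ?thesis
    by (simp add: bfgs_potential_def)
qed

section \<open>Gradients of convex functions\<close>

text \<open>The derivative D is represented by the vector \<open>adjoint D 1\<close>, and only by
  it, so the definite description in \<open>gradient\<close> is well defined.\<close>

lemma gradient_has_derivative:
  fixes f :: "real^'n \<Rightarrow> real"
  assumes "f differentiable (at x)"
  shows "(f has_derivative (\<lambda>h. gradient f x \<bullet> h)) (at x)"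
proof -
  obtain D where D: "(f has_derivative D) (at x)"
    using assms by (auto simp: differentiable_def)
  have "D h = adjoint D 1 \<bullet> h" for h
    using adjoint_works[OF has_derivative_linear[OF D], of h 1] by (simp add: inner_commute)
  then have "(f has_derivative (\<lambda>h. adjoint D 1 \<bullet> h)) (at x)"
    using D by (metis (no_types, lifting) ext)
  moreover have "g = g'" if "(f has_derivative (\<lambda>h. g \<bullet> h)) (at x)"
    and "(f has_derivative (\<lambda>h. g' \<bullet> h)) (at x)" for g g'
  proof -
    have "g \<bullet> h = g' \<bullet> h" for h
      using has_derivative_unique[OF that] by meson
    then show ?thesis
      using vector_eq_rdot by (metis inner_commute)
  qed
  ultimately have "\<exists>!g. (f has_derivative (\<lambda>h. g \<bullet> h)) (at x)"
    by blast
  then show ?thesis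
    unfolding gradient_def by (rule theI')
qed

text \<open>Restriction to the line through z and w reduces this to the tangent inequality in one
  variable.\<close>

lemma convex_on_gradient_le:
  fixes f :: "real^'n \<Rightarrow> real"
  assumes "open U" "convex_on U f" "z \<in> U" "w \<in> U" "f differentiable (at z)"
  shows "f z + gradient f z \<bullet> (w - z) \<le> f w"
proof -
  define l where "l = (\<lambda>\<tau>::real. z + \<tau> *\<^sub>R (w - z))"
  \<comment> \<open>The full preimage of U, rather than the unit interval, makes the parameter 0 an
    interior point, as the one-variable inequality requires.\<close>
  define A where "A = l -` U"
  have l_cvx: "l ((1 - u) * a + u * b) = (1 - u) *\<^sub>R l a + u *\<^sub>R l b" for u a b
    by (simp add: l_def algebra_simps)
  have "convex U"
    using assms(2) convex_on_imp_convex by blast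
  have convA: "convex A"
    unfolding convex_alt A_def
  proof (intro ballI allI impI)
    fix a b u :: real
    assume "a \<in> l -` U" "b \<in> l -` U" "0 \<le> u \<and> u \<le> 1"
    then show "(1 - u) *\<^sub>R a + u *\<^sub>R b \<in> l -` U"
      using \<open>convex U\<close> by (auto simp: l_cvx convex_alt)
  qed
  have "convex_on A (f \<circ> l)"
  proof (rule convex_onI[OF _ convA])
    fix u a b :: real
    assume "0 < u" "u < 1" "a \<in> A" "b \<in> A"
    then show "(f \<circ> l) ((1 - u) *\<^sub>R a + u *\<^sub>R b) \<le> (1 - u) * (f \<circ> l) a + u * (f \<circ> l) b"
      using convex_onD[OF assms(2), of u "l a" "l b"] by (simp add: l_cvx A_def)
  qed
  moreover have "continuous_on UNIV l"
    unfolding l_def by (intro continuous_intros)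
  then have "open A"
    unfolding A_def using assms(1) by (simp add: open_vimage)
  moreover have l01: "l 0 = z" "l 1 = w"
    by (auto simp: l_def)
  moreover have "(f \<circ> l has_field_derivative gradient f z \<bullet> (w - z)) (at 0)"
  proof -
    have "(l has_derivative (\<lambda>h. h *\<^sub>R (w - z))) (at 0)"
      unfolding l_def by (auto intro!: derivative_eq_intros)
    moreover have "(f has_derivative (\<lambda>h. gradient f z \<bullet> h)) (at (l 0))"
      using gradient_has_derivative[OF assms(5)] l01 by simp
    ultimately have "(f \<circ> l has_derivative (\<lambda>h. gradient f z \<bullet> h) \<circ> (\<lambda>h. h *\<^sub>R (w - z))) (at 0)"
      by (rule diff_chain_at)
    moreover have "(\<lambda>h. gradient f z \<bullet> h) \<circ> (\<lambda>h. h *\<^sub>R (w - z)) = (*) (gradient f z \<bullet> (w - z))"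
      by (simp add: fun_eq_iff)
    ultimately show ?thesis
      by (simp add: has_field_derivative_def)
  qed
  ultimately have "(f \<circ> l) 1 - (f \<circ> l) 0 \<ge> gradient f z \<bullet> (w - z) * (1 - 0)"
    using assms(3,4) convA
    by (intro convex_on_imp_above_tangent[of A "f \<circ> l"])
      (auto simp: interior_open convex_connected A_def intro: has_field_derivative_at_within)
  then show ?thesis
    by (simp add: l01)
qed

text \<open>The tangent inequalities at z and at w are added.\<close>

lemma convex_on_gradient_monotone:
  fixes f :: "real^'n \<Rightarrow> real"
  assumes "open U" "convex_on U f" "z \<in> U" "w \<in> U" "f differentiable (at z)" "f differentiable (at w)"
  shows "0 \<le> (w - z) \<bullet> (gradient f w - gradient f z)"
proof -
  have "gradient f w \<bullet> (z - w) = - ((w - z) \<bullet> gradient f w)"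
    by (simp add: inner_commute inner_diff_right)
  moreover have "gradient f z \<bullet> (w - z) = (w - z) \<bullet> gradient f z"
    by (simp add: inner_commute)
  ultimately show ?thesis
    using convex_on_gradient_le[OF assms(1-4,5)] convex_on_gradient_le[OF assms(1,2,4,3,6)]
    by (simp add: inner_diff_right[of "w - z"])
qed

text \<open>Quadratic form and norm attain their extrema on the product of C with the unit sphere;
  homogeneity extends the bounds to all v. The attained minimum is positive.\<close>

lemma pos_def_mat_uniform_on_compact:
  fixes A :: "'a::metric_space \<Rightarrow> real^'n^'n"
  assumes "compact C" "continuous_on C A" "\<And>z. z \<in> C \<Longrightarrow> pos_def_mat (A z)"
  obtains m L where "m > 0" and "\<And>z v. z \<in> C \<Longrightarrow> m * (norm v)\<^sup>2 \<le> v \<bullet> (A z *v v)"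
    and "\<And>z v. z \<in> C \<Longrightarrow> norm (A z *v v) \<le> L * norm v"
proof (cases "C = {}")
  case True
  then show ?thesis
    using that[of 1] by auto
next
  case False
  define S where "S = C \<times> sphere (0 :: real^'n) 1"
  \<comment> \<open>Any coordinate vector shows that the sphere is nonempty.\<close>
  have "axis undefined 1 \<in> sphere (0 :: real^'n) 1"
    by simp
  then have S: "compact S" "S \<noteq> {}"
    using False assms(1) by (auto simp: S_def intro!: compact_Times)
  have "continuous_on S (\<lambda>p. A (fst p))"
    by (rule continuous_on_compose2[OF assms(2)]) (auto simp: S_def intro: continuous_intros)
  then have cont: "continuous_on S (\<lambda>p. A (fst p) *v snd p)"
    unfolding matrix_vector_mult_def
    by (intro continuous_on_vec_lambda continuous_on_sum continuous_on_mult continuous_on_component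
        continuous_on_snd continuous_on_id)
  obtain p where p: "p \<in> S" "\<And>q. q \<in> S \<Longrightarrow> snd p \<bullet> (A (fst p) *v snd p) \<le> snd q \<bullet> (A (fst q) *v snd q)"
    using continuous_attains_inf[OF S continuous_on_inner[OF continuous_on_snd[OF continuous_on_id] cont]]
    by blast
  obtain r where r: "r \<in> S" "\<And>q. q \<in> S \<Longrightarrow> norm (A (fst q) *v snd q) \<le> norm (A (fst r) *v snd r)"
    using continuous_attains_sup[OF S continuous_on_norm[OF cont]] by blast
  define m where "m = snd p \<bullet> (A (fst p) *v snd p)"
  define L where "L = norm (A (fst r) *v snd r)"
  have unit: "(z, v /\<^sub>R norm v) \<in> S" if "z \<in> C" "v \<noteq> 0" for z v
    using that by (simp add: S_def)
  show ?thesis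
  proof
    have "fst p \<in> C" "snd p \<noteq> 0"
      using p(1) by (auto simp: S_def)
    then show "m > 0"
      using assms(3) by (auto simp: m_def pos_def_mat_def)
  next
    fix z v assume z: "z \<in> C"
    show "m * (norm v)\<^sup>2 \<le> v \<bullet> (A z *v v)"
    proof (cases "v = 0")
      case False
      then have "m \<le> (v \<bullet> (A z *v v)) / (norm v)\<^sup>2"
        using p(2)[OF unit[OF z False]]
        by (simp add: m_def matrix_vector_mult_scaleR power2_eq_square divide_inverse mult.commute mult.left_commute)
      then show ?thesis
        using False by (simp add: field_simps)
    qed simp
    show "norm (A z *v v) \<le> L * norm v"
    proof (cases "v = 0")
      case False
      then have "norm (A z *v v) / norm v \<le> L"
        using r(2)[OF unit[OF z False]]
        by (simp add: L_def matrix_vector_mult_scaleR divide_inverse mult.commute)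
      then show ?thesis
        using False by (simp add: field_simps)
    qed simp
  qed
qed

text \<open>Pairing G with d gives a real function of \<tau> whose derivative is the quadratic form
  at d; the mean value theorem applies to it.\<close>

lemma strong_monotone_on_segment:
  fixes G :: "real^'n \<Rightarrow> real^'n"
  assumes "\<And>\<tau>. \<tau> \<in> {0..1} \<Longrightarrow> (G has_derivative (\<lambda>h. A (a + \<tau> *\<^sub>R d) *v h)) (at (a + \<tau> *\<^sub>R d))"
    and "\<And>\<tau>. \<tau> \<in> {0..1} \<Longrightarrow> m * (norm d)\<^sup>2 \<le> d \<bullet> (A (a + \<tau> *\<^sub>R d) *v d)"
  shows "m * (norm d)\<^sup>2 \<le> d \<bullet> (G (a + d) - G a)"
proof -
  define \<phi> where "\<phi> = (\<lambda>\<tau>. d \<bullet> G (a + \<tau> *\<^sub>R d))"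
  have der: "(\<phi> has_derivative (\<lambda>h. d \<bullet> (A (a + \<tau> *\<^sub>R d) *v (h *\<^sub>R d)))) (at \<tau> within {0..1})"
    if "\<tau> \<in> {0..1}" for \<tau>
  proof -
    have "((\<lambda>\<tau>. a + \<tau> *\<^sub>R d) has_derivative (\<lambda>h. h *\<^sub>R d)) (at \<tau> within {0..1})"
      by (auto intro!: derivative_eq_intros)
    then have "((\<lambda>\<tau>. G (a + \<tau> *\<^sub>R d)) has_derivative (\<lambda>h. A (a + \<tau> *\<^sub>R d) *v (h *\<^sub>R d))) (at \<tau> within {0..1})"
      by (rule has_derivative_compose[where f = "\<lambda>\<tau>. a + \<tau> *\<^sub>R d", OF _ assms(1)[OF that]])
    then show ?thesis
      unfolding \<phi>_def by (rule has_derivative_inner_right)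
  qed
  obtain \<tau> where "\<tau> \<in> {0..1}" "\<phi> 1 - \<phi> 0 = d \<bullet> (A (a + \<tau> *\<^sub>R d) *v ((1 - 0) *\<^sub>R d))"
    using mvt_very_simple[of 0 1 \<phi> "\<lambda>\<tau> h. d \<bullet> (A (a + \<tau> *\<^sub>R d) *v (h *\<^sub>R d))"] der by auto
  then show ?thesis
    using assms(2)[of \<tau>] by (simp add: \<phi>_def inner_diff_right)
qed

text \<open>The segment between $a$ and $b$ may leave $V$, where nothing is known about the
  Hessian. Long segments are handled by strong convexity near $a$ alone, since the gradient is
  monotone along the rest of the segment.\<close>
lemma gradient_cocoercive_on_compact:
  fixes f :: "real^'n \<Rightarrow> real"
  assumes "open U" "convex_on U f" "open V" "V \<subseteq> U" "compact K" "K \<subseteq> V" "hessian_pd_cont_on f V"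
  obtains M where "\<And>a b. a \<in> K \<Longrightarrow> b \<in> K \<Longrightarrow>
    (norm (gradient f b - gradient f a))\<^sup>2 \<le> M * ((b - a) \<bullet> (gradient f b - gradient f a))"
proof -
  obtain Hf where diff: "\<And>z. z \<in> V \<Longrightarrow> f differentiable (at z)"
    and der: "\<And>z. z \<in> V \<Longrightarrow> (gradient f has_derivative (\<lambda>h. Hf z *v h)) (at z)"
    and pd: "\<And>z. z \<in> V \<Longrightarrow> pos_def_mat (Hf z)" and cont: "continuous_on V Hf"
    using assms(7) unfolding hessian_pd_cont_on_def by blast
  obtain \<delta> where \<delta>: "\<delta> > 0" "(\<Union>z\<in>K. cball z \<delta>) \<subseteq> V"
    using compact_subset_open_imp_cball_epsilon_subset[OF assms(5,3,6)] by blast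
  \<comment> \<open>The closed \<delta>-neighbourhood of K is still compact and inside V, so Hessian
    bounds hold uniformly on balls around points of K.\<close>
  define C where "C = {a + b | a b. a \<in> K \<and> b \<in> cball 0 \<delta>}"
  have C: "compact C"
    unfolding C_def by (intro compact_sums assms compact_cball)
  have CV: "C \<subseteq> V"
    using \<delta>(2) by (force simp: C_def dist_norm)
  have inC: "z \<in> C" if "a \<in> K" "dist a z \<le> \<delta>" for a z
  proof -
    have "z = a + (z - a)" "z - a \<in> cball 0 \<delta>"
      using that(2) by (auto simp: dist_norm norm_minus_commute)
    then show ?thesis
      unfolding C_def using that(1) by blast
  qed
  have "pos_def_mat (Hf z)" if "z \<in> C" for z
    using pd CV that by blast
  then obtain m L where m: "m > 0" "\<And>z v. z \<in> C \<Longrightarrow> m * (norm v)\<^sup>2 \<le> v \<bullet> (Hf z *v v)"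
    and L: "\<And>z v. z \<in> C \<Longrightarrow> norm (Hf z *v v) \<le> L * norm v"
    using pos_def_mat_uniform_on_compact[OF C continuous_on_subset[OF cont CV]] by blast
  have "continuous_on K (gradient f)"
    using der assms(6) by (meson continuous_at_imp_continuous_on has_derivative_continuous subsetD)
  then have "bounded (gradient f ` K)"
    using assms(5) compact_continuous_image compact_imp_bounded by blast
  then obtain G where G: "\<And>a. a \<in> K \<Longrightarrow> norm (gradient f a) \<le> G"
    by (auto simp: bounded_iff)
  have strong: "m * (norm d)\<^sup>2 \<le> d \<bullet> (gradient f (a + d) - gradient f a)" if "a \<in> K" "norm d \<le> \<delta>" for a d
  proof (rule strong_monotone_on_segment[of _ Hf])
    fix \<tau> :: real assume "\<tau> \<in> {0..1}"
    then have "norm (\<tau> *\<^sub>R d) \<le> \<delta>"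
      using that(2) mult_left_le_one_le[of "norm d" "\<tau>"] by simp
    then have "a + \<tau> *\<^sub>R d \<in> C"
      using inC that(1) by (simp add: dist_norm)
    then show "(gradient f has_derivative (*v) (Hf (a + \<tau> *\<^sub>R d))) (at (a + \<tau> *\<^sub>R d))"
      "m * (norm d)\<^sup>2 \<le> d \<bullet> (Hf (a + \<tau> *\<^sub>R d) *v d)"
      using der m(2) CV by auto
  qed
  \<comment> \<open>The first entry serves short segments, where |y| \<le> L |s| and m |s|^2 \<le>
    s^T y. The second serves long ones, where |y| \<le> 2 G and m \<delta>^2 \<le> s^T y.\<close>
  define M where "M = max (L\<^sup>2 / m) ((2 * G)\<^sup>2 / (m * \<delta>\<^sup>2))"
  show ?thesis
  proof
    fix a b assume ab: "a \<in> K" "b \<in> K"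
    define s where "s = b - a"
    define y where "y = gradient f b - gradient f a"
    have abV: "a \<in> V" "b \<in> V"
      using ab assms(6) by auto
    have sy: "0 \<le> s \<bullet> y"
      unfolding s_def y_def using abV assms(1,2,4) diff by (intro convex_on_gradient_monotone[of U]) auto
    show "(norm y)\<^sup>2 \<le> M * (s \<bullet> y)"
    proof (cases "norm s \<le> \<delta>")
      case True
      have "norm y \<le> L * norm s"
        unfolding y_def s_def
      proof (rule differentiable_bound[of "cball a \<delta>" _ "\<lambda>z h. Hf z *v h"])
        fix z assume "z \<in> cball a \<delta>"
        then have "z \<in> C"
          using inC ab by simp
        then show "(gradient f has_derivative (*v) (Hf z)) (at z within cball a \<delta>)"
          "onorm ((*v) (Hf z)) \<le> L"
          using der CV L by (auto intro: has_derivative_at_withinI onorm_le)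
      qed (use True \<delta> in \<open>auto simp: s_def dist_norm norm_minus_commute\<close>)
      then have "(norm y)\<^sup>2 \<le> (L * norm s)\<^sup>2"
        by (intro power_mono) auto
      also have "\<dots> = L\<^sup>2 / m * (m * (norm s)\<^sup>2)"
        using m by (simp add: power_mult_distrib)
      also have "\<dots> \<le> L\<^sup>2 / m * (s \<bullet> y)"
        using strong[OF ab(1) True] m(1) by (intro mult_left_mono) (auto simp: s_def y_def)
      also have "\<dots> \<le> M * (s \<bullet> y)"
        using sy by (intro mult_right_mono) (auto simp: M_def)
      finally show ?thesis .
    next
      case False
      \<comment> \<open>The initial piece d of s has length exactly \<delta>, so a + d stays in
        C.\<close>
      define q where "q = \<delta> / norm s"
      define d where "d = q *\<^sub>R s"
      have ns: "0 < norm s" "\<delta> < norm s"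
        using False \<delta>(1) by linarith+
      have q: "0 < q" "q < 1"
        using ns \<delta>(1) by (simp_all add: q_def)
      have nd: "norm d = \<delta>"
        using ns \<delta>(1) by (simp add: d_def q_def)
      have adC: "a + d \<in> V"
        using inC[OF ab(1)] nd CV by (auto simp: dist_norm)
      have "0 \<le> (b - (a + d)) \<bullet> (gradient f b - gradient f (a + d))"
        using abV adC assms(1,2,4) diff by (intro convex_on_gradient_monotone[of U]) auto
      also have "b - (a + d) = (1 - q) *\<^sub>R s"
        by (simp add: d_def s_def algebra_simps)
      finally have "0 \<le> s \<bullet> (gradient f b - gradient f (a + d))"
        using q by (simp add: zero_le_mult_iff)
      then have "d \<bullet> (gradient f (a + d) - gradient f a) \<le> q * (s \<bullet> y)"
        using q by (simp add: d_def y_def inner_diff_right right_diff_distrib)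
      also have "\<dots> \<le> s \<bullet> y"
        using q sy by (simp add: mult_left_le_one_le)
      finally have \<sigma>: "m * \<delta>\<^sup>2 \<le> s \<bullet> y"
        using strong[OF ab(1), of d] nd by simp
      have "norm y \<le> 2 * G"
        using norm_triangle_ineq4[of "gradient f b" "gradient f a"] G[OF ab(1)] G[OF ab(2)]
        by (simp add: y_def)
      then have "(norm y)\<^sup>2 \<le> (2 * G)\<^sup>2"
        by (intro power_mono) auto
      also have "\<dots> = (2 * G)\<^sup>2 / (m * \<delta>\<^sup>2) * (m * \<delta>\<^sup>2)"
        using m \<delta> by simp
      also have "\<dots> \<le> (2 * G)\<^sup>2 / (m * \<delta>\<^sup>2) * (s \<bullet> y)"
        using \<sigma> m(1) by (intro mult_left_mono) auto
      also have "\<dots> \<le> M * (s \<bullet> y)"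
        using sy by (intro mult_right_mono) (auto simp: M_def)
      finally show ?thesis .
    qed
  qed
qed

section \<open>Convergence of function values\<close>

lemma not_bounded_below_if_eventually_decreasing:
  fixes P :: "nat \<Rightarrow> real"
  assumes "\<And>k. k \<ge> N \<Longrightarrow> P (Suc k) \<le> P k - 1"
  shows "\<not> (\<forall>k. c \<le> P k)"
proof
  assume bd: "\<forall>k. c \<le> P k"
  have *: "P (N + j) \<le> P N - real j" for j
  proof (induction j)
    case (Suc j)
    then show ?case
      using assms[of "N + j"] by simp
  qed simp
  obtain j where "P N - c < real j"
    using reals_Archimedean2 by blast
  then show False
    using *[of j] bd[rule_format, of "N + j"] by simp
qed

text \<open>The uncontrolled scaling t is collected in r, a lower bound for the loss of trace. The
  determinant factor contributes at most ln r plus a term free of t, and ln r \<le> r lets the loss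
  of trace absorb ln r.\<close>

lemma bfgs_potential_update_le:
  fixes H :: "real^'n^'n"
  assumes "pos_def_mat H" "H *v g = - (t *\<^sub>R s)" "t > 0" "g \<bullet> s < 0" "s \<bullet> y > 0"
    and "\<nu> < 1" "(\<nu> - 1) * (g \<bullet> s) \<le> s \<bullet> y" "(norm y)\<^sup>2 \<le> M * (s \<bullet> y)" "0 < \<epsilon>" "\<epsilon> \<le> norm g"
  shows "bfgs_potential (bfgs_update H s y) \<le> bfgs_potential H + M + ln (- (g \<bullet> s) / (\<epsilon>\<^sup>2 * (1 - \<nu>)))"
proof -
  define a where "a = - (g \<bullet> s)"
  define r where "r = \<epsilon>\<^sup>2 / (t * a)"
  have a: "a > 0"
    using assms by (simp add: a_def)
  have r: "r > 0"
    using a assms by (simp add: r_def)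
  have "\<epsilon>\<^sup>2 \<le> g \<bullet> g"
    unfolding power2_norm_eq_inner[symmetric] using assms by (intro power_mono) auto
  then have 1: "r \<le> (g \<bullet> g) / (t * a)"
    unfolding r_def using a assms by (intro divide_right_mono) auto
  have 2: "(y \<bullet> y) / (s \<bullet> y) \<le> M"
    using assms by (simp add: power2_norm_eq_inner pos_divide_le_eq)
  have \<sigma>: "(1 - \<nu>) * a \<le> s \<bullet> y"
    using assms(7) by (simp add: a_def algebra_simps)
  \<comment> \<open>The Wolfe condition replaces s^T y by a multiple of a, so that a cancels; it is
    then reintroduced through r.\<close>
  have "a / (t * (s \<bullet> y)) \<le> a / (t * ((1 - \<nu>) * a))"
    using a assms \<sigma> by (intro divide_left_mono mult_left_mono mult_pos_pos) auto
  also have "\<dots> = r * (a / (\<epsilon>\<^sup>2 * (1 - \<nu>)))"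
    using a assms by (simp add: r_def field_simps)
  finally have "ln (a / (t * (s \<bullet> y))) \<le> ln (r * (a / (\<epsilon>\<^sup>2 * (1 - \<nu>))))"
    using a assms by (intro ln_mono divide_pos_pos mult_pos_pos) auto
  also have "\<dots> = ln r + ln (a / (\<epsilon>\<^sup>2 * (1 - \<nu>)))"
    using a r assms by (intro ln_mult_pos divide_pos_pos mult_pos_pos) auto
  also have "ln r \<le> r"
    using ln_le_minus_one[OF r] by simp
  finally show ?thesis
    using 1 2 bfgs_potential_update[OF assms(1-5)] by (simp add: a_def)
qed

theorem theorem3p2:
  fixes f :: "real^'n \<Rightarrow> real" and U V :: "(real^'n) set" and x :: "nat \<Rightarrow> real^'n"
  assumes "open U" and "convex U" and "convex_on U f"
    and "bfgs_seq f x" and "\<forall>k. x k \<in> U"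
    and "bounded {z \<in> U. f z \<le> f (x 0)}"
    and "open V" and "V \<subseteq> U" and "closure (range x) \<subseteq> V"
    and "Inf (f ` V) = Inf (f ` U)"
    and "hessian_pd_cont_on f V"
  shows "(\<lambda>k. f (x k)) \<longlonglongrightarrow> Inf (f ` U)"
proof -

  \<comment> \<open>Well-definedness and descent of the iteration\<close>
  define K where "K = closure (range x)"
  define g where "g = (\<lambda>k. gradient f (x k))"
  define s where "s = (\<lambda>k. x (Suc k) - x k)"
  define y where "y = (\<lambda>k. g (Suc k) - g k)"
  obtain \<mu> \<nu> H0 where \<mu>\<nu>: "0 < \<mu>" "\<mu> < \<nu>" "\<nu> < 1" and H0: "pos_def_mat H0"
    and dir: "\<And>k. \<exists>t\<ge>0. bfgs_H f H0 x k *v g k = - (t *\<^sub>R s k)"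
    and armijo: "\<And>k. f (x (Suc k)) \<le> f (x k) + \<mu> * (g k \<bullet> s k)"
    and wolfe: "\<And>k. \<nu> * (g k \<bullet> s k) \<le> g (Suc k) \<bullet> s k"
    using assms(4) unfolding bfgs_seq_def Let_def g_def s_def by blast
  have g0: "g k \<noteq> 0" for k
    using assms(4) by (simp add: bfgs_seq_def g_def)
  define H where "H = bfgs_H f H0 x"
  have H_Suc: "H (Suc k) = bfgs_update (H k) (s k) (y k)" for k
    by (simp add: H_def bfgs_update_def s_def y_def g_def Let_def)
  have curv: "(\<nu> - 1) * (g k \<bullet> s k) \<le> s k \<bullet> y k" for k
    using wolfe[of k] by (simp add: y_def inner_diff_right inner_commute algebra_simps)
  \<comment> \<open>Positive definiteness gives 0 < g^T H g = -t g^T s, which fixes both signs; the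
    Wolfe condition then gives s^T y > 0. The statement is conditional because the induction for
    \<open>pd\<close> uses it.\<close>
  have step: "\<exists>t>0. H k *v g k = - (t *\<^sub>R s k) \<and> g k \<bullet> s k < 0 \<and> s k \<bullet> y k > 0"
    if "pos_def_mat (H k)" for k
  proof -
    obtain t where t: "t \<ge> 0" "H k *v g k = - (t *\<^sub>R s k)"
      using dir unfolding H_def by blast
    have "0 < g k \<bullet> (H k *v g k)"
      using that g0 by (simp add: pos_def_mat_def)
    then have "t * (g k \<bullet> s k) < 0"
      by (simp add: t)
    then have *: "t > 0" "g k \<bullet> s k < 0"
      using t(1) by (auto simp: mult_less_0_iff)
    then have "0 < (\<nu> - 1) * (g k \<bullet> s k)"
      using \<mu>\<nu> by (intro mult_neg_neg) auto
    then show ?thesis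
      using t * curv[of k] by force
  qed
  have pd: "pos_def_mat (H k)" for k
  proof (induction k)
    case 0
    then show ?case
      by (simp add: H_def H0)
  next
    case (Suc k)
    then show ?case
      using step bfgs_update_pos_def_det(1) H_Suc by metis
  qed
  have gs: "g k \<bullet> s k < 0" for k
    using step pd by blast
  have dec: "f (x (Suc k)) \<le> f (x k)" for k
    using armijo[of k] mult_pos_neg[OF \<mu>\<nu>(1) gs[of k]] by simp
  have antimono: "f (x k) \<le> f (x j)" if "j \<le> k" for j k
    using lift_Suc_antimono_le[of "\<lambda>k. f (x k)"] dec that by blast

  \<comment> \<open>Compactness and the limit of the directional derivatives\<close>
  have "range x \<subseteq> {z \<in> U. f z \<le> f (x 0)}"
    using assms(5) antimono by auto
  then have K: "compact K" "K \<subseteq> V" "K \<noteq> {}"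
    using assms(6,9) bounded_subset by (auto simp: K_def)
  have xK: "x k \<in> K" for k
    unfolding K_def by (rule subsetD[OF closure_subset rangeI])
  have diff: "f differentiable (at z)" if "z \<in> V" for z
    using assms(11) that by (auto simp: hessian_pd_cont_on_def)
  have "isCont (gradient f) z" if "z \<in> V" for z
    using assms(11) that unfolding hessian_pd_cont_on_def by (metis has_derivative_continuous)
  then have contg: "continuous_on K (gradient f)"
    using K(2) by (meson continuous_at_imp_continuous_on subsetD)
  have isCont_f: "isCont f z" if "z \<in> V" for z
    using diff[OF that] by (rule differentiable_imp_continuous_within)
  then have "continuous_on K f"
    using K(2) by (meson continuous_at_imp_continuous_on subsetD)
  then obtain b where b: "\<And>k. f b \<le> f (x k)"
    using continuous_attains_inf[OF K(1,3)] xK by blast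
  have "decseq (\<lambda>k. f (x k))"
    using antimono by (simp add: decseq_def)
  then obtain l where l: "(\<lambda>k. f (x k)) \<longlonglongrightarrow> l"
    by (rule decseq_convergent[where B = "f b"]) (simp add: b)
  \<comment> \<open>Armijo bounds each term by a difference of consecutive function values, and
    these values converge.\<close>
  have gs_lim: "(\<lambda>k. - (g k \<bullet> s k)) \<longlonglongrightarrow> 0"
  proof (rule tendsto_sandwich)
    show "\<forall>\<^sub>F k in sequentially. 0 \<le> - (g k \<bullet> s k)"
      using gs by (simp add: less_imp_le)
    show "\<forall>\<^sub>F k in sequentially. - (g k \<bullet> s k) \<le> (f (x k) - f (x (Suc k))) / \<mu>"
      using armijo \<mu>\<nu>(1) by (simp add: field_simps)
    have "(\<lambda>k. (f (x k) - f (x (Suc k))) / \<mu>) \<longlonglongrightarrow> (l - l) / \<mu>"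
      using \<mu>\<nu>(1) by (intro tendsto_intros l LIMSEQ_Suc) auto
    then show "(\<lambda>k. (f (x k) - f (x (Suc k))) / \<mu>) \<longlonglongrightarrow> 0"
      by simp
  qed auto

  \<comment> \<open>A critical point in the closure of the sequence\<close>
  obtain M where M: "\<And>a b. a \<in> K \<Longrightarrow> b \<in> K \<Longrightarrow>
      (norm (gradient f b - gradient f a))\<^sup>2 \<le> M * ((b - a) \<bullet> (gradient f b - gradient f a))"
    using gradient_cocoercive_on_compact[OF assms(1,3,7,8) K(1,2) assms(11)] by blast
  \<comment> \<open>A minimizer of the gradient norm over K: were its gradient nonzero, that norm
    would be the uniform bound \<epsilon>.\<close>
  obtain z where z: "z \<in> K" "\<And>k. norm (gradient f z) \<le> norm (g k)"
    using continuous_attains_inf[OF K(1,3) continuous_on_norm[OF contg]] xK unfolding g_def by blast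
  have "gradient f z = 0"
  proof (rule ccontr)
    assume nz: "gradient f z \<noteq> 0"
    define \<epsilon> where "\<epsilon> = norm (gradient f z)"
    have \<epsilon>: "\<epsilon> > 0" "\<And>k. \<epsilon> \<le> norm (g k)"
      using nz z by (auto simp: \<epsilon>_def)
    define w where "w = \<epsilon>\<^sup>2 * (1 - \<nu>)"
    have w: "w > 0"
      using \<epsilon> \<mu>\<nu> by (simp add: w_def)
    \<comment> \<open>Below this threshold the logarithm is at most -1 - M, so each update lowers
      the potential by at least 1.\<close>
    have "w * exp (- 1 - M) > 0"
      using w by simp
    then obtain N where N: "\<And>k. k \<ge> N \<Longrightarrow> - (g k \<bullet> s k) < w * exp (- 1 - M)"
      using order_tendstoD(2)[OF gs_lim] unfolding eventually_sequentially by blast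
    have "bfgs_potential (H (Suc k)) \<le> bfgs_potential (H k) - 1" if "k \<ge> N" for k
    proof -
      obtain t where t: "t > 0" "H k *v g k = - (t *\<^sub>R s k)" "s k \<bullet> y k > 0"
        using step[OF pd] by blast
      have "(norm (y k))\<^sup>2 \<le> M * (s k \<bullet> y k)"
        using M[OF xK xK] by (simp add: y_def s_def g_def)
      then have "bfgs_potential (H (Suc k)) \<le> bfgs_potential (H k) + M + ln (- (g k \<bullet> s k) / w)"
        unfolding H_Suc w_def
        by (intro bfgs_potential_update_le[OF pd t(2,1) gs t(3) \<mu>\<nu>(3) curv _ \<epsilon>])
      also have "ln (- (g k \<bullet> s k) / w) \<le> ln (exp (- 1 - M))"
        using gs[of k] w N[OF that] by (intro ln_mono divide_pos_pos) (auto simp: field_simps)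
      finally show ?thesis
        by simp
    qed
    then have "\<not> (\<forall>k. c \<le> bfgs_potential (H k))" for c
      by (rule not_bounded_below_if_eventually_decreasing)
    then show False
      using bfgs_potential_bounded_below pd by metis
  qed

  \<comment> \<open>From the critical point to the limit of the values\<close>
  then have "f z \<le> f u" if "u \<in> U" for u
    using convex_on_gradient_le[OF assms(1,3) _ that diff, of z] z(1) K(2) assms(8) by auto
  moreover have zU: "z \<in> U"
    using z(1) K(2) assms(8) by blast
  ultimately have Inf: "Inf (f ` U) = f z"
    by (intro cInf_eq_minimum) auto
  \<comment> \<open>Some iterate comes close enough to z to have a value below v; monotonicity keeps
    all later values there.\<close>
  have "(\<lambda>k. f (x k)) \<longlonglongrightarrow> f z"
  proof (rule decreasing_tendsto)
    show "\<forall>\<^sub>F k in sequentially. f z \<le> f (x k)"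
      using \<open>\<And>u. u \<in> U \<Longrightarrow> f z \<le> f u\<close> assms(5) by simp
    fix v assume "f z < v"
    have "isCont f z"
      using isCont_f z(1) K(2) by blast
    \<comment> \<open>The filter omits z itself, hence the later case distinction on
      \<open>x j = z\<close>.\<close>
    then have "\<forall>\<^sub>F u in at z. f u < v"
      using \<open>f z < v\<close> by (auto simp: isCont_def dest: order_tendstoD(2))
    then obtain W where W: "open W" "z \<in> W" "\<forall>u\<in>W. u \<noteq> z \<longrightarrow> f u < v"
      unfolding eventually_at_topological by blast
    then have "W \<inter> range x \<noteq> {}"
      using z(1) open_Int_closure_eq_empty[OF W(1), of "range x"] unfolding K_def by blast
    then obtain j where "x j \<in> W"
      by blast
    then have "f (x j) < v"
      using W(3) \<open>f z < v\<close> by (cases "x j = z") auto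
    then have "f (x k) < v" if "k \<ge> j" for k
      by (rule le_less_trans[OF antimono[OF that]])
    then show "\<forall>\<^sub>F k in sequentially. f (x k) < v"
      unfolding eventually_sequentially by blast
  qed
  then show ?thesis
    using Inf by simp
qed

end
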